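(* For every three-dimensional real inner-product space $V$, every full-rank lattice $\mathcal L\subset V$, every $\boldsymbol\alpha\in V$, and every integer $N\ge 2$, $$ g_N(\boldsymbol\alpha,\mathcal L)\le 9. $$
   Context: Let $V$ be a finite-dimensional real inner-product space with induced norm $\|\cdot\|$, $\mathcal L\subset V$ a full-rank lattice (a discrete subgroup spanning $V$), and $\boldsymbol\alpha\in V$. For integers $N\ge 2$ and $1\le n\le N$, set $$\delta_{n,N}=\min\{\|(m-n)\boldsymbol\alpha+\ell\| : m\in\mathbb Z,\ 1\le m\le N,\ \ell\in\mathcal L,\ (m-n)\boldsymbol\alpha+\ell\neq 0\}.$$ (The choice $m=n$ is allowed, in which case $\ell$ is a nonzero lattice vector.) Define $g_N(\boldsymbol\alpha,\mathcal L)=\#\{\delta_{n,N}:1\le n\le N\}$, the number of distinct values among $\delta_{1,N},\dots,\delta_{N,N}$. *)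

theory Defs
  imports "HOL-Analysis.Analysis"
begin

definition full_rank_lattice :: "'a::euclidean_space set \<Rightarrow> bool" where
  "full_rank_lattice L \<longleftrightarrow>
     0 \<in> L \<and> (\<forall>x\<in>L. \<forall>y\<in>L. x + y \<in> L) \<and> (\<forall>x\<in>L. - x \<in> L) \<and>
     discrete L \<and> span L = UNIV"

text \<open>The indices \<open>m\<close> and \<open>n\<close> are subtracted as reals, since subtraction on \<open>nat\<close> truncates.\<close>

definition gap_vectors :: "'a::euclidean_space \<Rightarrow> 'a set \<Rightarrow> nat \<Rightarrow> nat \<Rightarrow> 'a set" where
  "gap_vectors \<alpha> L N n =
     {(real m - real n) *\<^sub>R \<alpha> + l | m l.
        1 \<le> m \<and> m \<le> N \<and> l \<in> L \<and> (real m - real n) *\<^sub>R \<alpha> + l \<noteq> 0}"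

text \<open>\<open>Min\<close> is meaningful only for finite sets, so the minimum is written with \<open>LEAST\<close>; it is
  attained by lemma \<open>gap_attained\<close> below.\<close>

definition gap :: "'a::euclidean_space \<Rightarrow> 'a set \<Rightarrow> nat \<Rightarrow> nat \<Rightarrow> real" where
  "gap \<alpha> L N n = (LEAST d. d \<in> norm ` gap_vectors \<alpha> L N n)"

definition num_gaps :: "'a::euclidean_space \<Rightarrow> 'a set \<Rightarrow> nat \<Rightarrow> nat" where
  "num_gaps \<alpha> L N = card (gap \<alpha> L N ` {1..N})"

lemma full_rank_lattice_finite_ball:
  assumes "full_rank_lattice L"
  shows "finite (L \<inter> cball 0 r)"
proof -
  have "0 isolated_in L"
    using assms by (auto simp: full_rank_lattice_def discrete_def)
  then obtain e where e: "e > 0" "\<And>y. y \<in> L \<Longrightarrow> norm y < e \<Longrightarrow> y = 0"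
    by (auto simp: isolated_in_dist_Ex_iff)
  have "x = y" if "x \<in> L" "y \<in> L" "dist x y < e" for x y
  proof -
    have "x + - y \<in> L"
      using assms that unfolding full_rank_lattice_def by blast
    then show ?thesis
      using e(2)[of "x + - y"] that(3) by (simp add: dist_norm)
  qed
  then have "uniform_discrete L"
    using e(1) by (auto simp: uniform_discrete_def)
  then have "uniform_discrete (L \<inter> cball 0 r)"
    by (rule uniform_discrete_subset) auto
  then show ?thesis
    using uniform_discrete_finite_iff[of "L \<inter> cball 0 r"]
    by (simp add: bounded_Int)
qed

lemma gap_attained:
  fixes \<alpha> :: "'a::euclidean_space"
  assumes L: "full_rank_lattice L" and n: "1 \<le> n" "n \<le> N"
  shows "gap \<alpha> L N n \<in> norm ` gap_vectors \<alpha> L N n"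
    and "v \<in> gap_vectors \<alpha> L N n \<Longrightarrow> gap \<alpha> L N n \<le> norm v"
proof -
  let ?G = "gap_vectors \<alpha> L N n"
  obtain l where l: "l \<in> L" "l \<noteq> 0"
  proof -
    have "\<not> L \<subseteq> {0}"
    proof
      assume "L \<subseteq> {0}"
      then have "span L \<subseteq> {0 :: 'a}"
        by (simp add: span_minimal)
      moreover have "span L = (UNIV :: 'a set)"
        using L by (simp add: full_rank_lattice_def)
      ultimately show False
        using nonempty_Basis nonzero_Basis by blast
    qed
    then show ?thesis using that by blast
  qed
  have "(real n - real n) *\<^sub>R \<alpha> + l \<in> ?G"
    unfolding gap_vectors_def using l n by (force intro!: exI[of _ n] exI[of _ l])
  then have lG: "l \<in> ?G" by simp
  let ?F = "{v \<in> ?G. norm v \<le> norm l}"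
  have "?F \<subseteq> (\<Union>m\<in>{1..N}. (\<lambda>k. (real m - real n) *\<^sub>R \<alpha> + k) `
                (L \<inter> cball 0 (norm l + norm ((real m - real n) *\<^sub>R \<alpha>))))"
  proof
    fix v assume "v \<in> ?F"
    then obtain m k where v: "v = (real m - real n) *\<^sub>R \<alpha> + k" "1 \<le> m" "m \<le> N" "k \<in> L"
        "norm v \<le> norm l"
      by (auto simp: gap_vectors_def)
    have "norm k \<le> norm v + norm ((real m - real n) *\<^sub>R \<alpha>)"
      using norm_triangle_ineq4[of v "(real m - real n) *\<^sub>R \<alpha>"] by (simp add: v(1))
    then show "v \<in> (\<Union>m\<in>{1..N}. (\<lambda>k. (real m - real n) *\<^sub>R \<alpha> + k) `
                (L \<inter> cball 0 (norm l + norm ((real m - real n) *\<^sub>R \<alpha>))))"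
      using v by (intro UN_I[of m] image_eqI[of _ _ k]) auto
  qed
  then have fin: "finite ?F"
    by (rule finite_subset) (intro finite_UN_I finite_imageI full_rank_lattice_finite_ball L finite_atLeastAtMost)
  have "l \<in> ?F" using lG by simp
  then have "?F \<noteq> {}" by blast
  then obtain w where "is_arg_min norm (\<lambda>v. v \<in> ?F) w"
    using ex_is_arg_min_if_finite[OF fin, of norm] by blast
  then have w: "w \<in> ?F" "\<And>v. v \<in> ?F \<Longrightarrow> norm w \<le> norm v"
    by (simp_all add: is_arg_min_linorder)
  have least: "norm w \<le> norm v" if "v \<in> ?G" for v
    using w that by (cases "norm v \<le> norm l") auto
  have "gap \<alpha> L N n = norm w"
    unfolding gap_def using w(1) least by (intro Least_equality) auto
  then show "gap \<alpha> L N n \<in> norm ` ?G" and "v \<in> ?G \<Longrightarrow> gap \<alpha> L N n \<le> norm v"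
    using w(1) least by auto
qed

end

theory Submission
  imports Defs
begin

text \<open>
  Up to sign, \<open>\<delta>\<^sub>n\<close> is the minimum of the nonzero norms \<open>\<parallel>k\<alpha> + l\<parallel>\<close> over \<open>0 \<le> k \<le> max (n - 1) (N - n)\<close>,
  so the number of gaps is at most one more than the number of indices \<open>K < k \<le> 2K\<close>, with
  \<open>K = \<lfloor>N/2\<rfloor>\<close>, at which this minimum drops. Let \<open>v\<^sub>k = k\<alpha> + l\<^sub>k\<close> realise the drop at \<open>k\<close>, and let \<open>u\<close>
  be the last drop. The pairs \<open>(k, l\<^sub>k)\<close> are pairwise incongruent modulo \<open>2\<Lambda> + \<int>(u, l\<^sub>u)\<close>, where
  \<open>\<Lambda> = \<int> \<times> \<L>\<close>: if for instance \<open>v\<^sub>i - v\<^sub>j + v\<^sub>u\<close> is twice a point and \<open>i < j\<close>, then the halves of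
  \<open>v\<^sub>i - v\<^sub>j + v\<^sub>u\<close>, \<open>v\<^sub>i + v\<^sub>j - v\<^sub>u\<close> and \<open>v\<^sub>j - v\<^sub>i + v\<^sub>u\<close> have small indices, hence are long, which
  contradicts the identity for the sum of the squares of \<open>\<parallel>\<plusminus>v\<^sub>i \<plusminus> v\<^sub>j \<plusminus> v\<^sub>u\<parallel>\<close>. Since
  \<open>(u, l\<^sub>u) \<notin> 2\<Lambda>\<close>, there are at most \<open>2\<^sup>d\<close> such classes in dimension \<open>d\<close>.
\<close>

section \<open>Residue classes of a lattice modulo two\<close>

lemma full_rank_lattice_add: "full_rank_lattice L \<Longrightarrow> x \<in> L \<Longrightarrow> y \<in> L \<Longrightarrow> x + y \<in> L"
  and full_rank_lattice_minus: "full_rank_lattice L \<Longrightarrow> x \<in> L \<Longrightarrow> - x \<in> L"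
  and full_rank_lattice_zero: "full_rank_lattice L \<Longrightarrow> 0 \<in> L"
  by (auto simp: full_rank_lattice_def)

lemma full_rank_lattice_diff: "full_rank_lattice L \<Longrightarrow> x \<in> L \<Longrightarrow> y \<in> L \<Longrightarrow> x - y \<in> L"
  using full_rank_lattice_add[of L x "- y"] full_rank_lattice_minus[of L y] by simp

lemma full_rank_lattice_scale_nat:
  assumes "full_rank_lattice L" "x \<in> L"
  shows "real n *\<^sub>R x \<in> L"
  by (induction n)
     (auto simp: assms full_rank_lattice_zero scaleR_left_distrib intro!: full_rank_lattice_add)

lemma full_rank_lattice_scale_int:
  assumes "full_rank_lattice L" "x \<in> L"
  shows "of_int k *\<^sub>R x \<in> L"
  using full_rank_lattice_scale_nat[OF assms] full_rank_lattice_minus[OF assms(1)]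
  by (cases k rule: int_cases2) fastforce+

lemma full_rank_lattice_sum:
  assumes "full_rank_lattice L" "\<And>b. b \<in> B \<Longrightarrow> f b \<in> L"
  shows "sum f B \<in> L"
  using assms(2)
  by (induction B rule: infinite_finite_induct)
     (auto simp: assms(1) full_rank_lattice_zero intro!: full_rank_lattice_add)

text \<open>With \<open>M\<close> the sublattice spanned by a basis contained in \<open>L\<close>, this is the index computation
  \<open>[L : 2L] [2L : 2M] = [L : M] [M : 2M]\<close>, where \<open>[2L : 2M] = [L : M]\<close> is finite.\<close>

lemma card_incongruent_mod_2:
  fixes L :: "'a::euclidean_space set"
  assumes L: "full_rank_lattice L" and X: "finite X" "X \<subseteq> L"
    and incong: "\<And>x y z. x \<in> X \<Longrightarrow> y \<in> X \<Longrightarrow> z \<in> L \<Longrightarrow> x - y = 2 *\<^sub>R z \<Longrightarrow> x = y"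
  shows "card X \<le> 2 ^ DIM('a)"
proof -
  obtain B where B: "B \<subseteq> L" "independent B" "L \<subseteq> span B" "card B = dim L"
    using basis_exists[of L] by blast
  have span: "span B = UNIV"
    using B L by (metis full_rank_lattice_def span_minimal subspace_span top.extremum_uniqueI)
  have fin: "finite B" using B(2) by (rule independent_imp_finite)
  have cardB: "card B = DIM('a)"
    using B(2) span by (metis dim_UNIV dim_eq_card_independent dim_span)
  define c where "c y b = representation B y b" for y b
  have c: "(\<Sum>b\<in>B. c y b *\<^sub>R b) = y" for y
    unfolding c_def using sum_representation_eq[OF B(2) _ fin order_refl, of y] span by simp
  define int_part where "int_part y = (\<Sum>b\<in>B. of_int \<lfloor>c y b\<rfloor> *\<^sub>R b)" for y
  have int_part: "int_part y \<in> L" for y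
    unfolding int_part_def using B(1)
    by (intro full_rank_lattice_sum full_rank_lattice_scale_int L) auto
  \<comment> \<open>\<open>T\<close> represents \<open>L\<close> modulo the integer span M of
    \<open>B\<close>, reduced to the half-open parallelepiped on \<open>B\<close>. Being a bounded
    subset of \<open>L\<close>, it is finite.\<close>
  define T where "T = (\<lambda>y. y - int_part y) ` L"
  have TL: "T \<subseteq> L"
    unfolding T_def using int_part L by (auto intro: full_rank_lattice_diff)
  have "norm (y - int_part y) \<le> (\<Sum>b\<in>B. norm b)" for y
  proof -
    have "y - int_part y = (\<Sum>b\<in>B. frac (c y b) *\<^sub>R b)"
      by (subst (1) c[of y, symmetric])
         (simp add: int_part_def frac_def sum_subtractf scaleR_left_diff_distrib)
    moreover have "norm (frac (c y b) *\<^sub>R b) \<le> norm b" for b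
      using frac_lt_1[of "c y b"] frac_ge_0[of "c y b"] mult_right_mono[of "frac (c y b)" 1 "norm b"]
      by simp
    ultimately show ?thesis by (simp add: sum_norm_le)
  qed
  then have "T \<subseteq> L \<inter> cball 0 (\<Sum>b\<in>B. norm b)"
    using TL by (auto simp: T_def)
  then have finT: "finite T"
    using full_rank_lattice_finite_ball[OF L] finite_subset by blast
  have "T \<noteq> {}" unfolding T_def using full_rank_lattice_zero[OF L] by blast
  then have cT: "card T > 0" using finT by (simp add: card_gt_0_iff)
  \<comment> \<open>The representative in \<open>T\<close> fixes the class modulo M, and the
    parities of the integer coordinates refine it to a class modulo 2M. Hence there are at most
    \<open>card T * 2 ^ card B\<close> codes.\<close>
  define code where "code y = (y - int_part y, {b\<in>B. odd \<lfloor>c y b\<rfloor>})" for y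
  have code_cong: "\<exists>f :: 'a \<Rightarrow> int. y - y' = 2 *\<^sub>R (\<Sum>b\<in>B. of_int (f b) *\<^sub>R b)"
    if "code y = code y'" for y y'
  proof -
    have "even (\<lfloor>c y b\<rfloor> - \<lfloor>c y' b\<rfloor>)" if "b \<in> B" for b
      using \<open>code y = code y'\<close> that unfolding code_def by auto
    then have half: "of_int \<lfloor>c y b\<rfloor> - of_int \<lfloor>c y' b\<rfloor>
        = 2 * (of_int ((\<lfloor>c y b\<rfloor> - \<lfloor>c y' b\<rfloor>) div 2) :: real)" if "b \<in> B" for b
      using that by (metis dvd_mult_div_cancel of_int_diff of_int_mult of_int_numeral)
    have "y - y' = int_part y - int_part y'"
      using that by (auto simp: code_def algebra_simps)
    also have "\<dots> = (\<Sum>b\<in>B. (of_int \<lfloor>c y b\<rfloor> - of_int \<lfloor>c y' b\<rfloor>) *\<^sub>R b)"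
      by (simp add: int_part_def sum_subtractf scaleR_left_diff_distrib)
    also have "\<dots> = (\<Sum>b\<in>B. (2 * of_int ((\<lfloor>c y b\<rfloor> - \<lfloor>c y' b\<rfloor>) div 2)) *\<^sub>R b)"
      by (intro sum.cong refl arg_cong2[of _ _ _ _ scaleR] half)
    also have "\<dots> = 2 *\<^sub>R (\<Sum>b\<in>B. of_int ((\<lfloor>c y b\<rfloor> - \<lfloor>c y' b\<rfloor>) div 2) *\<^sub>R b)"
      by (simp only: scaleR_sum_right scaleR_scaleR)
    finally show ?thesis by (rule exI[of _ "\<lambda>b. (\<lfloor>c y b\<rfloor> - \<lfloor>c y' b\<rfloor>) div 2"])
  qed
  have int_part_translate: "y = y'"
    if y: "y \<in> T" "y' \<in> T" and eq: "y - y' = (\<Sum>b\<in>B. of_int (f b) *\<^sub>R b)" for y y' f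
  proof -
    have c_comb: "c (\<Sum>b\<in>B. g b *\<^sub>R b) b = g b" if "b \<in> B" for g b
    proof -
      have "c (\<Sum>b\<in>B. g b *\<^sub>R b) b = (\<Sum>x\<in>B. g x * representation B x b)"
        unfolding c_def
        by (subst representation_sum[OF B(2)])
           (simp_all add: span representation_scale[OF B(2)])
      also have "\<dots> = (\<Sum>x\<in>B. if x = b then g x else 0)"
        by (intro sum.cong refl) (simp add: representation_basis[OF B(2)])
      also have "\<dots> = g b" using fin that by simp
      finally show ?thesis .
    qed
    have frac_T: "0 \<le> c t b \<and> c t b < 1" if t: "t \<in> T" and b: "b \<in> B" for t b
    proof -
      obtain z where "t = z - int_part z" using t unfolding T_def by blast
      then have "t = (\<Sum>b\<in>B. frac (c z b) *\<^sub>R b)"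
        using c[of z] by (simp add: int_part_def frac_def sum_subtractf scaleR_left_diff_distrib)
      then show ?thesis using c_comb[OF b] frac_lt_1 frac_ge_0 by metis
    qed
    have "f b = 0" if b: "b \<in> B" for b
    proof -
      have "y = (\<Sum>b\<in>B. (c y' b + of_int (f b)) *\<^sub>R b)"
        using eq c[of y'] by (simp add: scaleR_left_distrib sum.distrib algebra_simps)
      then have "c y b = c y' b + of_int (f b)" using c_comb[OF b] by metis
      then show ?thesis using frac_T[OF y(1) b] frac_T[OF y(2) b] by linarith
    qed
    then show ?thesis using eq by simp
  qed
  \<comment> \<open>Equal codes give congruence modulo 2M. Reduction modulo 2L yields
    \<open>x = x'\<close> by incongruence; halving the rest puts \<open>t - t'\<close> in M, so
    \<open>t = t'\<close>.\<close>
  have "inj_on (\<lambda>(x, t). code (x + 2 *\<^sub>R t)) (X \<times> T)"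
  proof (rule inj_onI)
    fix p q assume "p \<in> X \<times> T" "q \<in> X \<times> T"
      and eq: "(case p of (x, t) \<Rightarrow> code (x + 2 *\<^sub>R t)) = (case q of (x, t) \<Rightarrow> code (x + 2 *\<^sub>R t))"
    then obtain x t x' t' where p: "p = (x, t)" and q: "q = (x', t')"
      and *: "x \<in> X" "t \<in> T" "x' \<in> X" "t' \<in> T" "code (x + 2 *\<^sub>R t) = code (x' + 2 *\<^sub>R t')"
      by auto
    obtain f :: "'a \<Rightarrow> int" where
      f: "(x + 2 *\<^sub>R t) - (x' + 2 *\<^sub>R t') = 2 *\<^sub>R (\<Sum>b\<in>B. of_int (f b) *\<^sub>R b)"
      using code_cong[OF *(5)] by blast
    let ?m = "\<Sum>b\<in>B. of_int (f b) *\<^sub>R b"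
    have m: "?m \<in> L" using B(1)
      by (intro full_rank_lattice_sum full_rank_lattice_scale_int L) auto
    have "?m - (t - t') \<in> L"
      using m * TL by (intro full_rank_lattice_diff L) auto
    moreover have "x - x' = 2 *\<^sub>R (?m - (t - t'))"
      using f by (simp add: algebra_simps)
    ultimately have x: "x = x'" using incong * by blast
    have "2 *\<^sub>R (t - t') = 2 *\<^sub>R ?m" using f x by (simp add: algebra_simps)
    then have "t - t' = ?m" by simp
    then show "p = q" unfolding p q using int_part_translate[OF *(2,4)] x by blast
  qed
  moreover have "(\<lambda>(x, t). code (x + 2 *\<^sub>R t)) ` (X \<times> T) \<subseteq> T \<times> Pow B"
  proof (rule image_subsetI)
    fix p assume "p \<in> X \<times> T"
    then obtain x t where p: "p = (x, t)" "x \<in> X" "t \<in> T" by blast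
    then have "x + (t + t) \<in> L" using X TL by (intro full_rank_lattice_add L) auto
    then have "x + 2 *\<^sub>R t \<in> L" by (simp add: scaleR_2)
    then show "(case p of (x, t) \<Rightarrow> code (x + 2 *\<^sub>R t)) \<in> T \<times> Pow B"
      by (auto simp: p(1) code_def T_def)
  qed
  ultimately have "card (X \<times> T) \<le> card (T \<times> Pow B)"
    using finT fin by (intro card_inj_on_le) auto
  then have "card X * card T \<le> 2 ^ DIM('a) * card T"
    using finT fin X(1) by (simp add: card_cartesian_product card_Pow cardB mult.commute)
  then show ?thesis using cT by simp
qed

text \<open>Among points whose integer coordinates have the same parity, congruence modulo 2 is
  decided by the lattice coordinate alone, so each of the two parities contributes at most
  \<open>2 ^ DIM('a)\<close> points.\<close>

lemma card_incongruent_mod_2_int_times: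
  fixes L :: "'a::euclidean_space set"
  assumes L: "full_rank_lattice L" and X: "finite X" "X \<subseteq> UNIV \<times> L"
    and incong: "\<And>k l k' l' j z. (k, l) \<in> X \<Longrightarrow> (k', l') \<in> X \<Longrightarrow> z \<in> L \<Longrightarrow>
      k - k' = 2 * (j::int) \<Longrightarrow> l - l' = 2 *\<^sub>R z \<Longrightarrow> (k, l) = (k', l')"
  shows "card X \<le> 2 * 2 ^ DIM('a)"
proof -
  have half: "card {p \<in> X. even (fst p) = e} \<le> 2 ^ DIM('a)" for e
  proof -
    let ?Y = "{p \<in> X. even (fst p) = e}"
    have eq: "p = q" if pq: "p \<in> ?Y" "q \<in> ?Y" "z \<in> L" "snd p - snd q = 2 *\<^sub>R z" for p q z
    proof -
      have "even (fst p - fst q)" using pq by auto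
      then obtain j where "fst p - fst q = 2 * j" by blast
      then show ?thesis using incong[of "fst p" "snd p" "fst q" "snd q" z j] pq by simp
    qed
    have "inj_on snd ?Y"
    proof (rule inj_onI)
      fix p q assume "p \<in> ?Y" "q \<in> ?Y" "snd p = snd q"
      then show "p = q" using eq[of p q 0] full_rank_lattice_zero[OF L] by simp
    qed
    then have "card ?Y = card (snd ` ?Y)" by (simp add: card_image)
    also have "\<dots> \<le> 2 ^ DIM('a)"
    proof (rule card_incongruent_mod_2[OF L])
      show "finite (snd ` ?Y)" using X by simp
      show "snd ` ?Y \<subseteq> L" using X by auto
      fix x y z assume xy: "x \<in> snd ` ?Y" "y \<in> snd ` ?Y" and z: "z \<in> L" "x - y = 2 *\<^sub>R z"
      obtain p where p: "p \<in> ?Y" "x = snd p" using xy(1) by (rule imageE)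
      obtain q where q: "q \<in> ?Y" "y = snd q" using xy(2) by (rule imageE)
      have "p = q" using eq[OF p(1) q(1) z(1)] z(2) unfolding p(2) q(2) .
      then show "x = y" using p q by simp
    qed
    finally show ?thesis .
  qed
  have "X = {p \<in> X. even (fst p) = True} \<union> {p \<in> X. even (fst p) = False}" by auto
  then have "card X \<le> card {p \<in> X. even (fst p) = True} + card {p \<in> X. even (fst p) = False}"
    using card_Un_le[of "{p \<in> X. even (fst p) = True}" "{p \<in> X. even (fst p) = False}"] by simp
  then show ?thesis using half[of True] half[of False] by linarith
qed

section \<open>The minimal norm with bounded index\<close>

text \<open>With \<open>n = 1\<close> and \<open>N = Suc K\<close> the difference
  \<open>m - n\<close> runs through 0, ..., \<open>K\<close>, so attainment is inherited from
  \<open>gap_attained\<close>.\<close>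

definition min_norm :: "'a::euclidean_space \<Rightarrow> 'a set \<Rightarrow> nat \<Rightarrow> real" where
  "min_norm \<alpha> L K = gap \<alpha> L (Suc K) 1"

text \<open>Negating a vector preserves its norm and flips its index, which extends the bound to the
  negative indices.\<close>

lemma min_norm_le:
  fixes \<alpha> :: "'a::euclidean_space"
  assumes L: "full_rank_lattice L" and l: "l \<in> L" and k: "\<bar>k\<bar> \<le> int K"
    and nz: "of_int k *\<^sub>R \<alpha> + l \<noteq> 0"
  shows "min_norm \<alpha> L K \<le> norm (of_int k *\<^sub>R \<alpha> + l)"
proof -
  have pos: "min_norm \<alpha> L K \<le> norm (real i *\<^sub>R \<alpha> + l)"
    if "l \<in> L" "i \<le> K" "real i *\<^sub>R \<alpha> + l \<noteq> 0" for i l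
  proof -
    have "real i *\<^sub>R \<alpha> + l \<in> gap_vectors \<alpha> L (Suc K) 1"
      unfolding gap_vectors_def using that
      by (intro CollectI exI[of _ "Suc i"] exI[of _ l]) auto
    then show ?thesis unfolding min_norm_def using gap_attained(2)[OF L] by simp
  qed
  show ?thesis
  proof (cases "k \<ge> 0")
    case True
    then show ?thesis using pos[of l "nat k"] l k nz by simp
  next
    case False
    have neg: "real (nat (- k)) *\<^sub>R \<alpha> + - l = - (of_int k *\<^sub>R \<alpha> + l)"
      using False by simp
    have "real (nat (- k)) *\<^sub>R \<alpha> + - l \<noteq> 0"
      using nz unfolding neg neg_equal_0_iff_equal .
    then have "min_norm \<alpha> L K \<le> norm (- (of_int k *\<^sub>R \<alpha> + l))"
      using pos[of "- l" "nat (- k)"] l k False full_rank_lattice_minus[OF L] unfolding neg by simp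
    then show ?thesis unfolding norm_minus_cancel .
  qed
qed

lemma min_norm_attained:
  fixes \<alpha> :: "'a::euclidean_space"
  assumes L: "full_rank_lattice L"
  obtains i l where "i \<le> K" "l \<in> L" "of_int (int i) *\<^sub>R \<alpha> + l \<noteq> 0"
    "min_norm \<alpha> L K = norm (of_int (int i) *\<^sub>R \<alpha> + l)"
proof -
  have "min_norm \<alpha> L K \<in> norm ` gap_vectors \<alpha> L (Suc K) 1"
    unfolding min_norm_def by (rule gap_attained(1)[OF L]) auto
  then obtain m l where m: "1 \<le> m" "m \<le> Suc K" "l \<in> L" "(real m - real 1) *\<^sub>R \<alpha> + l \<noteq> 0"
    "min_norm \<alpha> L K = norm ((real m - real 1) *\<^sub>R \<alpha> + l)"
    unfolding gap_vectors_def by blast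
  have "of_int (int (m - 1)) = real m - real 1" using m(1) by simp
  then show ?thesis using that[of "m - 1" l] m by simp
qed

lemma min_norm_antimono:
  assumes L: "full_rank_lattice L" and "K \<le> K'"
  shows "min_norm \<alpha> L K' \<le> min_norm \<alpha> L K"
proof -
  obtain i l where "i \<le> K" "l \<in> L" "of_int (int i) *\<^sub>R \<alpha> + l \<noteq> 0"
    "min_norm \<alpha> L K = norm (of_int (int i) *\<^sub>R \<alpha> + l)"
    using min_norm_attained[OF L] .
  then show ?thesis using min_norm_le[OF L, of l "int i" K' \<alpha>] assms(2) by simp
qed

text \<open>The indices \<open>m - n\<close> fill the range from \<open>-(n - 1)\<close> to
  \<open>N - n\<close>. A minimiser of index \<open>i\<close> is used as it stands with
  \<open>m = n + i\<close>, or negated with \<open>m = n - i\<close>.\<close>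

lemma gap_eq_min_norm:
  fixes \<alpha> :: "'a::euclidean_space"
  assumes L: "full_rank_lattice L" and n: "1 \<le> n" "n \<le> N"
  shows "gap \<alpha> L N n = min_norm \<alpha> L (max (n - 1) (N - n))"
proof (rule antisym)
  let ?K = "max (n - 1) (N - n)"
  obtain i l where i: "i \<le> ?K" "l \<in> L" "of_int (int i) *\<^sub>R \<alpha> + l \<noteq> 0"
    "min_norm \<alpha> L ?K = norm (of_int (int i) *\<^sub>R \<alpha> + l)"
    using min_norm_attained[OF L] .
  show "gap \<alpha> L N n \<le> min_norm \<alpha> L ?K"
  proof (cases "i \<le> N - n")
    case True
    have "of_int (int i) *\<^sub>R \<alpha> + l \<in> gap_vectors \<alpha> L N n"
      unfolding gap_vectors_def using True n i(2,3)
      by (intro CollectI exI[of _ "n + i"] exI[of _ l]) auto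
    then show ?thesis using gap_attained(2)[OF L n] i(4) by simp
  next
    case False
    then have le: "i \<le> n - 1" using i(1) by simp
    have "real (n - i) - real n = - real i" using le by simp
    then have eq: "- (of_int (int i) *\<^sub>R \<alpha> + l) = (real (n - i) - real n) *\<^sub>R \<alpha> + - l"
      by simp
    have "(real (n - i) - real n) *\<^sub>R \<alpha> + - l \<noteq> 0" using i(3) eq by (metis neg_equal_0_iff_equal)
    then have "- (of_int (int i) *\<^sub>R \<alpha> + l) \<in> gap_vectors \<alpha> L N n"
      unfolding gap_vectors_def eq using le n full_rank_lattice_minus[OF L i(2)]
      by (intro CollectI exI[of _ "n - i"] exI[of _ "- l"]) auto
    then have "gap \<alpha> L N n \<le> norm (- (of_int (int i) *\<^sub>R \<alpha> + l))"
      using gap_attained(2)[OF L n] by blast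
    then show ?thesis unfolding norm_minus_cancel i(4) .
  qed
  obtain m l where m: "1 \<le> m" "m \<le> N" "l \<in> L" "(real m - real n) *\<^sub>R \<alpha> + l \<noteq> 0"
    "gap \<alpha> L N n = norm ((real m - real n) *\<^sub>R \<alpha> + l)"
    using gap_attained(1)[OF L n] unfolding gap_vectors_def by blast
  have "real m - real n = of_int (int m - int n)" by simp
  then show "min_norm \<alpha> L ?K \<le> gap \<alpha> L N n"
    using min_norm_le[OF L m(3), of "int m - int n" ?K \<alpha>] m n by simp
qed

section \<open>Records\<close>

text \<open>The vectors \<open>w\<close>, \<open>a - w\<close>, \<open>w + b - a\<close> are the
  halves of \<open>a - b + c\<close>, \<open>a + b - c\<close>, \<open>b + c - a\<close>. With half
  of \<open>a + b + c\<close> added, their squared norms sum to those of \<open>a\<close>,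
  \<open>b\<close>, \<open>c\<close>, as mixed terms cancel; the lower bounds would push this sum
  above twice that of \<open>a\<close> plus that of \<open>b\<close>.\<close>

lemma halves_not_all_long:
  fixes a b c :: "'a::real_inner"
  assumes "norm c \<le> norm a"
    and "norm a < norm w" and "2 *\<^sub>R w = a - b + c"
    and "norm a < norm (a - w)" and "norm b \<le> norm (w + b - a)"
  shows False
proof -
  have w: "w = (1/2) *\<^sub>R (a - b + c)" using arg_cong[OF assms(3), of "\<lambda>x. (1/2) *\<^sub>R x"] by simp
  have "(norm w)\<^sup>2 + (norm (a - w))\<^sup>2 + (norm (w + b - a))\<^sup>2 + (norm ((1/2) *\<^sub>R (a + b + c)))\<^sup>2
      = (norm a)\<^sup>2 + (norm b)\<^sup>2 + (norm c)\<^sup>2"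
    unfolding w power2_norm_eq_inner
    by (simp add: inner_add_left inner_add_right inner_diff_left inner_diff_right inner_commute
        field_simps)
  moreover have "(norm a)\<^sup>2 < (norm w)\<^sup>2" "(norm a)\<^sup>2 < (norm (a - w))\<^sup>2"
    using assms(2,4) by (auto intro: power_strict_mono)
  moreover have "(norm b)\<^sup>2 \<le> (norm (w + b - a))\<^sup>2" "(norm c)\<^sup>2 \<le> (norm a)\<^sup>2"
    using assms(1,5) by (auto intro: power_mono)
  ultimately show False
    using zero_le_power2[of "norm ((1/2) *\<^sub>R (a + b + c))"] by linarith
qed

text \<open>The order of the indices bounds those of \<open>w\<close> and \<open>a - w\<close> by
  \<open>i - 1\<close> and that of \<open>w + b - a\<close> by \<open>j - 1\<close>, so these
  halves, if nonzero, are longer than the records \<open>a\<close> and \<open>b\<close>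
  respectively.\<close>

lemma records_incongruent:
  fixes \<alpha> :: "'a::euclidean_space" and i j k K :: nat
  assumes L: "full_rank_lattice L"
    and ord: "K < i" "i < j" "j \<le> k" "k \<le> 2 * K"
    and l: "la \<in> L" "lb \<in> L" "lc \<in> L" "z \<in> L"
    and a: "a = of_int (int i) *\<^sub>R \<alpha> + la" "a \<noteq> 0" "norm a < min_norm \<alpha> L (i - 1)"
    and b: "b = of_int (int j) *\<^sub>R \<alpha> + lb" "b \<noteq> 0" "norm b < min_norm \<alpha> L (j - 1)"
    and c: "c = of_int (int k) *\<^sub>R \<alpha> + lc" "c \<noteq> 0" "norm c \<le> norm a"
    and even: "int i - int j + int k = 2 * h" "la - lb + lc = 2 *\<^sub>R z"
  shows False
proof -
  define w where "w = of_int h *\<^sub>R \<alpha> + z"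
  have wL: "2 *\<^sub>R w = a - b + c"
  proof -
    have "2 *\<^sub>R w = of_int (2 * h) *\<^sub>R \<alpha> + 2 *\<^sub>R z" by (simp add: w_def algebra_simps)
    also have "\<dots> = a - b + c" unfolding even[symmetric] a b c by (simp add: algebra_simps)
    finally show ?thesis .
  qed
  have aw: "a - w = of_int (int i - h) *\<^sub>R \<alpha> + (la - z)"
    by (simp add: w_def a algebra_simps)
  have abw: "w + b - a = of_int (h + int j - int i) *\<^sub>R \<alpha> + (z + lb - la)"
    by (simp add: w_def a b algebra_simps)
  have long_w: "norm a < norm w" if "w \<noteq> 0"
    using min_norm_le[OF L, of z h "i - 1" \<alpha>] a(3) l that even(1) ord unfolding w_def by simp
  have long_aw: "norm a < norm (a - w)" if "a - w \<noteq> 0"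
    using min_norm_le[OF L, of "la - z" "int i - h" "i - 1" \<alpha>] a(3) l that even(1) ord
      full_rank_lattice_diff[OF L] unfolding aw by simp
  have long_abw: "norm b < norm (w + b - a)" if "w + b - a \<noteq> 0"
    using min_norm_le[OF L, of "z + lb - la" "h + int j - int i" "j - 1" \<alpha>] b(3) l that even(1) ord
      full_rank_lattice_diff[OF L] full_rank_lattice_add[OF L] unfolding abw by simp
  \<comment> \<open>Only nonzero vectors are bounded below. If \<open>w\<close> or
    \<open>a - w\<close> vanishes, the other equals \<open>a\<close>; if \<open>w + b - a\<close>
    vanishes, then \<open>w = c\<close>. Neither \<open>a\<close> nor \<open>c\<close> is longer
    than \<open>a\<close>.\<close>
  have w0: "w \<noteq> 0" using long_aw a(2) by auto
  have aw0: "a - w \<noteq> 0" using long_w a(2) by auto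
  have abw0: "w + b - a \<noteq> 0"
  proof
    assume "w + b - a = 0"
    then have "a - b = w" by (simp add: algebra_simps)
    then have "w = c" using wL by (simp add: scaleR_2)
    then show False using long_w w0 c(3) by simp
  qed
  show False
    using halves_not_all_long[OF c(3) long_w[OF w0] wL long_aw[OF aw0]] long_abw[OF abw0] by simp
qed

text \<open>Instead of forming a quotient by the last record, each record is counted twice, once as
  it is and once shifted by the last one. These points are pairwise incongruent modulo 2 in the
  product of the integers with \<open>L\<close>.\<close>

lemma card_records_le:
  fixes \<alpha> :: "'a::euclidean_space"
  assumes L: "full_rank_lattice L"
  shows "card {k \<in> {K<..2 * K}. min_norm \<alpha> L k < min_norm \<alpha> L (k - 1)} \<le> 2 ^ DIM('a)"
    (is "card ?R \<le> _")
proof (cases "?R = {}")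
  case True
  then show ?thesis by (simp only: card.empty)
next
  case False
  have finR: "finite ?R" by simp
  define u where "u = Max ?R"
  have u: "u \<in> ?R" unfolding u_def using Max_in[OF finR False] .
  have u_max: "k \<le> u" if "k \<in> ?R" for k unfolding u_def using Max_ge[OF finR that] .
  have "\<exists>l. l \<in> L \<and> of_int (int k) *\<^sub>R \<alpha> + l \<noteq> 0 \<and>
      min_norm \<alpha> L k = norm (of_int (int k) *\<^sub>R \<alpha> + l)" if k: "k \<in> ?R" for k
  proof -
    obtain i l where i: "i \<le> k" "l \<in> L" "of_int (int i) *\<^sub>R \<alpha> + l \<noteq> 0"
      "min_norm \<alpha> L k = norm (of_int (int i) *\<^sub>R \<alpha> + l)"
      using min_norm_attained[OF L] .
    \<comment> \<open>A minimiser of smaller index would already count for \<open>k - 1\<close>, so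
      the drop at \<open>k\<close> is realised at index exactly \<open>k\<close>.\<close>
    have "\<not> i \<le> k - 1"
    proof
      assume "i \<le> k - 1"
      then have "min_norm \<alpha> L (k - 1) \<le> min_norm \<alpha> L k"
        using min_norm_le[OF L i(2), of "int i" "k - 1" \<alpha>] i by simp
      then show False using k by simp
    qed
    then have "i = k" using i(1) by simp
    then show ?thesis using i by blast
  qed
  then have "\<forall>k\<in>?R. \<exists>l. l \<in> L \<and> of_int (int k) *\<^sub>R \<alpha> + l \<noteq> 0 \<and>
      min_norm \<alpha> L k = norm (of_int (int k) *\<^sub>R \<alpha> + l)"
    by (rule ballI)
  from bchoice[OF this] obtain l where l: "\<And>k. k \<in> ?R \<Longrightarrow> l k \<in> L"
    "\<And>k. k \<in> ?R \<Longrightarrow> of_int (int k) *\<^sub>R \<alpha> + l k \<noteq> 0"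
    "\<And>k. k \<in> ?R \<Longrightarrow> min_norm \<alpha> L k = norm (of_int (int k) *\<^sub>R \<alpha> + l k)"
    by blast
  define v where "v k = of_int (int k) *\<^sub>R \<alpha> + l k" for k :: nat
  have v: "v k \<noteq> 0" "min_norm \<alpha> L k = norm (v k)" "norm (v k) < min_norm \<alpha> L (k - 1)"
    if "k \<in> ?R" for k
    using l[OF that] that unfolding v_def by simp_all
  have v_less: "norm (v j) < norm (v i)" if "i \<in> ?R" "j \<in> ?R" "i < j" for i j
  proof -
    have "min_norm \<alpha> L (j - 1) \<le> min_norm \<alpha> L i"
      using that by (intro min_norm_antimono L) auto
    then show ?thesis using v[OF that(1)] v[OF that(2)] by linarith
  qed
  \<comment> \<open>Since \<open>K \<le> i - 1\<close>, every record is strictly below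
    \<open>min_norm \<alpha> L K\<close>, which bounds all nonzero vectors of index at most
    \<open>K\<close>.\<close>
  have short: "w = 0"
    if w: "w = of_int h *\<^sub>R \<alpha> + z" "z \<in> L" "\<bar>h\<bar> \<le> int K" "norm w \<le> norm (v i)" "i \<in> ?R"
    for w h z i
  proof (rule ccontr)
    assume "w \<noteq> 0"
    then have "min_norm \<alpha> L K \<le> norm w"
      using min_norm_le[OF L w(2), of h K \<alpha>] w by simp
    moreover have "min_norm \<alpha> L (i - 1) \<le> min_norm \<alpha> L K"
      using w(5) by (intro min_norm_antimono L) auto
    ultimately have "min_norm \<alpha> L (i - 1) \<le> norm w" by linarith
    then show False using w v(3)[OF w(5)] by simp
  qed
  \<comment> \<open>Equal shifts: half of \<open>v i - v j\<close> has small index and, by the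
    triangle inequality, norm at most that of \<open>v i\<close>. It is therefore zero, although the
    record norms differ.\<close>
  have incong0: "\<not> i < j"
    if ij: "i \<in> ?R" "j \<in> ?R" and z: "z \<in> L" "l i - l j = 2 *\<^sub>R z" "int i - int j = 2 * h"
    for i j z h
  proof
    assume less: "i < j"
    define w where "w = of_int h *\<^sub>R \<alpha> + z"
    have "2 *\<^sub>R w = of_int (2 * h) *\<^sub>R \<alpha> + 2 *\<^sub>R z" by (simp add: w_def algebra_simps)
    also have "\<dots> = v i - v j" unfolding z(2,3)[symmetric] v_def by (simp add: algebra_simps)
    finally have w2: "2 *\<^sub>R w = v i - v j" .
    have "2 * norm w = norm (v i - v j)" using arg_cong[OF w2, of norm] by simp
    also have "\<dots> \<le> norm (v i) + norm (v j)" by (rule norm_triangle_ineq4)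
    finally have "norm w \<le> norm (v i)" using v_less[OF ij less] by linarith
    moreover have "\<bar>h\<bar> \<le> int K" using z(3) ij by auto
    ultimately have "w = 0" using short w_def z(1) ij(1) by blast
    then show False using w2 v_less[OF ij less] by simp
  qed
  have incong1: False
    if ij: "i \<in> ?R" "j \<in> ?R" and z: "z \<in> L" "l i - l j + l u = 2 *\<^sub>R z"
      "int i - int j + int u = 2 * h" for i j z h
  proof -
    have main: False if ij: "i \<in> ?R" "j \<in> ?R" "i < j" and z: "z \<in> L" "l i - l j + l u = 2 *\<^sub>R z"
      "int i - int j + int u = 2 * h" for i j z h
    proof (rule records_incongruent[OF L])
      \<comment> \<open>Here \<open>j = u\<close> may occur, hence the weak inequality
        \<open>j \<le> k\<close> in \<open>records_incongruent\<close>.\<close>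
      show "K < i" "i < j" "u \<le> 2 * K" "j \<le> u" using ij u u_max by auto
      show "l i \<in> L" "l j \<in> L" "l u \<in> L" "z \<in> L" using l(1) ij u z by blast+
      show "v i = of_int (int i) *\<^sub>R \<alpha> + l i" "v j = of_int (int j) *\<^sub>R \<alpha> + l j"
        "v u = of_int (int u) *\<^sub>R \<alpha> + l u" by (simp_all only: v_def)
      show "v i \<noteq> 0" "v j \<noteq> 0" "v u \<noteq> 0" using v(1) ij u by blast+
      show "norm (v i) < min_norm \<alpha> L (i - 1)" "norm (v j) < min_norm \<alpha> L (j - 1)"
        using v(3) ij by blast+
      show "norm (v u) \<le> norm (v i)" using v_less[OF ij(1) u] ij u_max[OF ij(2)] by simp
      show "int i - int j + int u = 2 * h" "l i - l j + l u = 2 *\<^sub>R z" using z by blast+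
    qed
    consider "i < j" | "j < i" | "i = j" by linarith
    then show False
    proof cases
      case 1
      then show ?thesis using main ij z by blast
    next
      case 2
      \<comment> \<open>Subtracting the difference of the two records from the half interchanges
        \<open>i\<close> and \<open>j\<close>.\<close>
      have "z - (l i - l j) \<in> L" using z l(1) ij by (intro full_rank_lattice_diff L) auto
      moreover have "l j - l i + l u = 2 *\<^sub>R (z - (l i - l j))"
        using z(2) by (simp add: scaleR_2 algebra_simps)
      moreover have "int j - int i + int u = 2 * (h - (int i - int j))"
        using z(3) by simp
      ultimately show ?thesis using main ij 2 by blast
    next
      case 3
      \<comment> \<open>The last record would be twice a point; its half has index at most
        \<open>K\<close> and is too short to be nonzero.\<close>
      define w where "w = of_int h *\<^sub>R \<alpha> + z"
      have "2 *\<^sub>R w = of_int (2 * h) *\<^sub>R \<alpha> + 2 *\<^sub>R z" by (simp add: w_def algebra_simps)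
      also have "\<dots> = v u" unfolding z(2,3)[symmetric] v_def using 3 by simp
      finally have w2: "2 *\<^sub>R w = v u" .
      have "norm w \<le> norm (v u)" unfolding w2[symmetric] by simp
      moreover have "\<bar>h\<bar> \<le> int K" using z(3) 3 u by auto
      ultimately have "w = 0" using short w_def z(1) u by blast
      then show False using w2 v(1)[OF u] by simp
    qed
  qed
  define f where "f = (\<lambda>(k, e). (int k + (if e then int u else 0), l k + (if e then l u else 0)))"
  have f_incong: "p = q"
    if p: "p \<in> ?R \<times> UNIV" and q: "q \<in> ?R \<times> UNIV" and z: "z \<in> L"
      "fst (f p) - fst (f q) = 2 * h" "snd (f p) - snd (f q) = 2 *\<^sub>R z" for p q z h
  proof -
    obtain i d where pe: "p = (i, d)" and i: "i \<in> ?R" using p by blast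
    obtain j e where qe: "q = (j, e)" and j: "j \<in> ?R" using q by blast
    have neg: "- z \<in> L" using full_rank_lattice_minus[OF L z(1)] .
    consider "d = e" | "d" "\<not> e" | "\<not> d" "e" by blast
    then show ?thesis
    proof cases
      case 1
      then have e: "int i - int j = 2 * h" "l i - l j = 2 *\<^sub>R z"
        using z pe qe by (auto simp: f_def)
      moreover have "int j - int i = 2 * (- h)" "l j - l i = 2 *\<^sub>R (- z)"
        using e(1) arg_cong[OF e(2), of uminus] by simp_all
      ultimately have "\<not> i < j" "\<not> j < i" using incong0 i j z(1) neg by blast+
      then show ?thesis using 1 pe qe by simp
    next
      case 2
      then have "int i - int j + int u = 2 * h" "l i - l j + l u = 2 *\<^sub>R z"
        using z pe qe by (auto simp: f_def algebra_simps)
      then show ?thesis using incong1 i j z(1) by blast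
    next
      case 3
      then have e: "int i - int j - int u = 2 * h" "l i - l j - l u = 2 *\<^sub>R z"
        using z pe qe by (auto simp: f_def algebra_simps)
      have "int j - int i + int u = 2 * (- h)" "l j - l i + l u = 2 *\<^sub>R (- z)"
        using e(1) arg_cong[OF e(2), of uminus] by (simp_all add: algebra_simps)
      then show ?thesis using incong1 i j neg by blast
    qed
  qed
  have inj: "inj_on f (?R \<times> UNIV)"
  proof (rule inj_onI)
    fix p q assume "p \<in> ?R \<times> UNIV" "q \<in> ?R \<times> UNIV" "f p = f q"
    then show "p = q" using f_incong[of p q 0 0] full_rank_lattice_zero[OF L] by simp
  qed
  have "card (f ` (?R \<times> UNIV)) \<le> 2 * 2 ^ DIM('a)"
  proof (rule card_incongruent_mod_2_int_times[OF L])
    show "finite (f ` (?R \<times> UNIV))" by simp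
    show "f ` (?R \<times> UNIV) \<subseteq> UNIV \<times> L"
      using l(1) u full_rank_lattice_add[OF L] by (auto simp: f_def)
    fix k x k' x' h z
    assume "(k, x) \<in> f ` (?R \<times> UNIV)" "(k', x') \<in> f ` (?R \<times> UNIV)" and z: "z \<in> L"
      and eq: "k - k' = 2 * h" "x - x' = 2 *\<^sub>R z"
    then obtain p q where p: "p \<in> ?R \<times> UNIV" "(k, x) = f p" and q: "q \<in> ?R \<times> UNIV" "(k', x') = f q"
      by blast
    have "fst (f p) - fst (f q) = 2 * h" "snd (f p) - snd (f q) = 2 *\<^sub>R z"
      using eq unfolding p(2)[symmetric] q(2)[symmetric] by simp_all
    then have "p = q" using f_incong[OF p(1) q(1) z] by blast
    then show "(k, x) = (k', x')" using p q by simp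
  qed
  then have "card ?R * 2 \<le> 2 * 2 ^ DIM('a)"
    unfolding card_image[OF inj] card_cartesian_product by simp
  then show ?thesis by linarith
qed

section \<open>From records to distinct gap values\<close>

lemma num_gaps_le:
  fixes \<alpha> :: "'a::euclidean_space"
  assumes L: "full_rank_lattice L"
  shows "num_gaps \<alpha> L N \<le> 2 ^ DIM('a) + 1"
proof -
  define K where "K = N div 2"
  let ?R = "{k \<in> {K<..2 * K}. min_norm \<alpha> L k < min_norm \<alpha> L (k - 1)}"
  \<comment> \<open>From \<open>K\<close> upwards the minimum changes only at records; the starting
    value at \<open>K\<close> accounts for the extra 1.\<close>
  have cover: "k \<le> 2 * K \<longrightarrow> min_norm \<alpha> L k \<in> insert (min_norm \<alpha> L K) (min_norm \<alpha> L ` ?R)"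
    if "K \<le> k" for k
    using that
  proof (induction k rule: dec_induct)
    case (step k)
    show ?case
    proof (cases "min_norm \<alpha> L (Suc k) < min_norm \<alpha> L k")
      case True
      then show ?thesis using step by (intro impI insertI2 imageI) auto
    next
      case False
      then have "min_norm \<alpha> L (Suc k) = min_norm \<alpha> L k"
        using min_norm_antimono[OF L, of k "Suc k" \<alpha>] by simp
      then show ?thesis using step by auto
    qed
  qed simp
  have "gap \<alpha> L N ` {1..N} \<subseteq> insert (min_norm \<alpha> L K) (min_norm \<alpha> L ` ?R)"
  proof
    fix d assume "d \<in> gap \<alpha> L N ` {1..N}"
    then obtain n where n: "1 \<le> n" "n \<le> N" "d = gap \<alpha> L N n" by auto
    \<comment> \<open>The two arguments of \<open>max\<close> sum to \<open>N - 1\<close>, so the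
      larger is at least \<open>N div 2\<close>; it is at most
      \<open>N - 1 \<le> 2 * K\<close>.\<close>
    have "K \<le> max (n - 1) (N - n)" "max (n - 1) (N - n) \<le> 2 * K"
      unfolding K_def using n(1,2) by linarith+
    then show "d \<in> insert (min_norm \<alpha> L K) (min_norm \<alpha> L ` ?R)"
      using cover gap_eq_min_norm[OF L n(1,2), of \<alpha>] n(3) by simp
  qed
  then have "card (gap \<alpha> L N ` {1..N}) \<le> card (insert (min_norm \<alpha> L K) (min_norm \<alpha> L ` ?R))"
    by (intro card_mono) auto
  also have "\<dots> \<le> Suc (card (min_norm \<alpha> L ` ?R))"
    by (rule card_insert_le_m1) auto
  also have "\<dots> \<le> Suc (card ?R)" by (simp add: card_image_le)
  also have "\<dots> \<le> 2 ^ DIM('a) + 1" using card_records_le[OF L, of K \<alpha>] by simp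
  finally show ?thesis unfolding num_gaps_def .
qed

theorem theorem1p2:
  fixes \<alpha> :: "'a::euclidean_space" and L :: "'a set" and N :: nat
  assumes "DIM('a) = 3"
    and "full_rank_lattice L"
    and "N \<ge> 2"
  shows "num_gaps \<alpha> L N \<le> 9"
  using num_gaps_le[OF assms(2), of \<alpha> N] by (simp add: assms(1))

end
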